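(* Let $0\le\gamma<\pi/3$ and $\epsilon>0$. There is an online strategy with advice for two-dimensional vector packing which, on every input sequence $\sigma$ of $n$ vectors in $[0,1]^2$ each having angle $\arg v\in[\pi/4-\gamma/2,\ \pi/4+\gamma/2]$, reads $O(\epsilon^{-1}\log n)$ bits of advice and uses at most $c(\gamma,\epsilon)\,|\mathrm{OPT}(\sigma)|+1$ bins, where $$c(\gamma,\epsilon)=\max\left\{2,\ \frac{6}{1+3\tan(\pi/4-\gamma/2)}+\epsilon\right\}.$$
   Context: Online two-dimensional vector packing: an input sequence $\sigma=(v_1,v_2,\ldots)$ of vectors $v_i\in[0,1]^2$ is revealed one vector at a time; each vector must be irrevocably assigned, before the next arrives, to an already opened bin or to a newly opened bin. A set of vectors $B$ is a feasible bin if $\|\sum_{v\in B}v\|_\infty\le 1$. $\mathrm{OPT}(\sigma)$ is a packing of $\sigma$ into the minimum number of feasible bins. Advice-on-tape model: an oracle knowing the strategy and the whole input sequence writes a bit string on an advice tape of unbounded length (using a self-delimiting encoding), which the strategy may read at any time; the advice complexity is the number of advice bits read. The angle $\arg v$ of a vector $v=(v_x,v_y)$ is the angle it makes with the positive $x$-axis. *)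

theory Defs
  imports "HOL-Analysis.Analysis"
begin

definition angle :: "real^2 \<Rightarrow> real" where
  "angle v = Arg (Complex (v $ 1) (v $ 2))"

text \<open>
  A packing of the input \<open>\<sigma>\<close> is a list \<open>p\<close> of bin labels, \<open>p ! i\<close> being the bin that receives
  \<open>\<sigma> ! i\<close>. Labels carry no meaning and need not be consecutive: a bin is opened when its label
  occurs for the first time, and the number of bins used is the number of distinct labels.
\<close>

definition feasible_packing :: "(real^2) list \<Rightarrow> nat list \<Rightarrow> bool" where
  "feasible_packing \<sigma> p \<longleftrightarrow> length p = length \<sigma> \<and>
     (\<forall>k. infnorm (\<Sum>i | i < length \<sigma> \<and> p ! i = k. \<sigma> ! i) \<le> 1)"

definition num_bins :: "nat list \<Rightarrow> nat" where
  "num_bins p = card (set p)"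

definition opt :: "(real^2) list \<Rightarrow> nat" where
  "opt \<sigma> = (LEAST m. \<exists>p. feasible_packing \<sigma> p \<and> num_bins p = m)"

text \<open>
  A strategy is a deterministic function of the vectors revealed so far (the last one is the vector
  to be packed) and of the advice bits read so far. Its earlier decisions are determined by these
  data, so they are not passed as a further argument. It either asks for the next advice bit or
  irrevocably places the current vector. It learns neither the length of the input nor anything
  about the unread part of the tape.
\<close>

datatype action = Read_Bit | Place nat

type_synonym strategy = "(real^2) list \<Rightarrow> bool list \<Rightarrow> action"

text \<open>
  \<open>serve S tape \<sigma> r k r'\<close>: with \<open>\<sigma>\<close> revealed and the first \<open>r\<close> bits of the tape already read, the
  strategy puts the last vector of \<open>\<sigma>\<close> into bin \<open>k\<close>, at which point \<open>r'\<close> bits have been read.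
\<close>

inductive serve :: "strategy \<Rightarrow> (nat \<Rightarrow> bool) \<Rightarrow> (real^2) list \<Rightarrow> nat \<Rightarrow> nat \<Rightarrow> nat \<Rightarrow> bool"
  for S tape \<sigma> where
  place: "S \<sigma> (map tape [0..<r]) = Place k \<Longrightarrow> serve S tape \<sigma> r k r"
| read: "S \<sigma> (map tape [0..<r]) = Read_Bit \<Longrightarrow> serve S tape \<sigma> (Suc r) k r' \<Longrightarrow> serve S tape \<sigma> r k r'"

text \<open>
  \<open>run S tape \<sigma> p b\<close>: on input \<open>\<sigma>\<close> the strategy produces the assignment \<open>p\<close> and reads \<open>b\<close> advice
  bits in total. No such \<open>p\<close>, \<open>b\<close> exist if it keeps reading forever at some vector.
\<close>

inductive run :: "strategy \<Rightarrow> (nat \<Rightarrow> bool) \<Rightarrow> (real^2) list \<Rightarrow> nat list \<Rightarrow> nat \<Rightarrow> bool"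
  for S tape where
  start: "run S tape [] [] 0"
| step: "run S tape \<sigma> p r \<Longrightarrow> serve S tape (\<sigma> @ [v]) r k r' \<Longrightarrow> run S tape (\<sigma> @ [v]) (p @ [k]) r'"

lemma serve_deterministic:
  "serve S tape \<sigma> r k s \<Longrightarrow> serve S tape \<sigma> r k' s' \<Longrightarrow> k' = k \<and> s' = s"
proof (induction arbitrary: k' s' rule: serve.induct)
  case (place r k)
  from place.prems place.hyps show ?case by (auto elim: serve.cases)
next
  case (read r k s)
  from read.prems have "serve S tape \<sigma> (Suc r) k' s'"
    by cases (simp_all add: read.hyps)
  then show ?case by (rule read.IH)
qed

lemma run_deterministic:
  "run S tape \<sigma> p b \<Longrightarrow> run S tape \<sigma> p' b' \<Longrightarrow> p' = p \<and> b' = b"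
proof (induction arbitrary: p' b' rule: run.induct)
  case start
  then show ?case by cases simp_all
next
  case (step \<sigma> p r v k r')
  from step.prems obtain q s k' where
    "p' = q @ [k']" "run S tape \<sigma> q s" "serve S tape (\<sigma> @ [v]) s k' b'"
    by cases simp_all
  then show ?case
    using step.IH[of q s] serve_deterministic[OF step.hyps(2)] by simp
qed

lemma infnorm_le_1:
  assumes "v \<in> cbox 0 (1 :: real^2)"
  shows "infnorm v \<le> 1"
proof -
  have "0 \<le> v $ i \<and> v $ i \<le> 1" for i
    using assms by (simp add: mem_box_cart)
  then have "\<bar>v $ i\<bar> \<le> 1" for i
    by (subst abs_of_nonneg) auto
  then show ?thesis
    unfolding infnorm_cart by (intro cSup_least) auto
qed

lemma opt_attained:
  assumes "set \<sigma> \<subseteq> cbox 0 1"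
  shows "\<exists>p. feasible_packing \<sigma> p \<and> num_bins p = opt \<sigma>"
proof -
  have "infnorm (\<Sum>i | i < length \<sigma> \<and> [0..<length \<sigma>] ! i = k. \<sigma> ! i) \<le> 1" for k
  proof -
    have eq: "{i. i < length \<sigma> \<and> [0..<length \<sigma>] ! i = k} = (if k < length \<sigma> then {k} else {})"
      by auto
    show ?thesis
    proof (cases "k < length \<sigma>")
      case True
      then have "\<sigma> ! k \<in> cbox 0 1" using assms nth_mem by blast
      then show ?thesis using True by (simp add: eq infnorm_le_1)
    qed (simp add: eq infnorm_0)
  qed
  then have "feasible_packing \<sigma> [0..<length \<sigma>]"
    by (simp add: feasible_packing_def)
  then have "\<exists>m p. feasible_packing \<sigma> p \<and> num_bins p = m"
    by blast
  then show ?thesis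
    unfolding opt_def by (rule LeastI_ex)
qed

end

theory Submission
  imports Defs
begin

text \<open>
  Let \<open>t = tan (\<pi>/4 - \<gamma>/2)\<close>, so that a vector of norm above \<open>c\<close> has volume (sum of its
  coordinates) above \<open>(1 + t) c\<close>, while the total volume is at most \<open>2 OPT\<close>. In a first-fit
  packing any two bins together have volume above \<open>1 + t\<close>, which gives \<open>4/(1 + t) OPT + 1\<close> bins;
  this suffices if \<open>t \<le> 1/3\<close> or \<open>\<epsilon> \<ge> 4\<close>.

  Otherwise the advice is the number \<open>N\<close> of critical vectors, those with norm in \<open>(1/2, 2/3]\<close>.
  The bins below \<open>N\<close> keep room for one critical vector each, and all other vectors are packed by
  first fit with capacity \<open>1/3\<close> in these bins and \<open>1\<close> in the remaining ones. If no tiny vector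
  (norm at most \<open>1/3\<close>) overflows into the bins from \<open>N\<close> on, count with weight \<open>1\<close> for norm above
  \<open>1/2\<close> and weight \<open>1/2\<close> for norm in \<open>(1/3, 1/2]\<close>: all bins but one have weight at least \<open>1\<close>,
  and a feasible bin has weight at most \<open>2\<close>, since \<open>t > 1/3\<close>. If a tiny vector does overflow, then
  the bins below \<open>N\<close> carry a volume of at least \<open>(1 + t)/6\<close> on average besides their critical
  vectors, and at most two of the other bins are light, that is, of volume below \<open>2/3 (1 + t)\<close>.
  The average volume is then \<open>2/3 (1 + t)\<close> up to one bin, which gives
  \<open>3/(1 + t) OPT + 1 \<le> 6/(1 + 3 t) OPT + 1\<close> bins.
\<close>

section \<open>Vectors in a cone around the diagonal\<close>

lemma infnorm_le_iff: "infnorm (v :: real^2) \<le> c \<longleftrightarrow> \<bar>v $ 1\<bar> \<le> c \<and> \<bar>v $ 2\<bar> \<le> c"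
proof -
  have "{\<bar>v $ i\<bar> |i. i \<in> UNIV} = {\<bar>v $ 1\<bar>, \<bar>v $ 2\<bar>}"
    by (auto, metis exhaust_2)
  then have "infnorm v = max \<bar>v $ 1\<bar> \<bar>v $ 2\<bar>"
    by (simp add: infnorm_cart cSup_eq_Max)
  then show ?thesis by simp
qed

text \<open>For \<open>t = tan a\<close> with 0 \<le> a \<le> \<pi>/4 these are 0 and the vectors at
  angle between a and \<pi>/2 - a. Linear inequalities replace the angle because they pass directly
  to sums.\<close>

definition diag_cone :: "real \<Rightarrow> (real^2) set" where
  "diag_cone t = {v. 0 \<le> v $ 1 \<and> 0 \<le> v $ 2 \<and> t * v $ 1 \<le> v $ 2 \<and> t * v $ 2 \<le> v $ 1}"

lemma cone_zero: "0 \<in> diag_cone t"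
  by (simp add: diag_cone_def)

lemma cone_add: "v \<in> diag_cone t \<Longrightarrow> w \<in> diag_cone t \<Longrightarrow> v + w \<in> diag_cone t"
  by (auto simp: diag_cone_def algebra_simps)

lemma cone_sum: "(\<And>i. i \<in> A \<Longrightarrow> g i \<in> diag_cone t) \<Longrightarrow> sum g A \<in> diag_cone t"
  by (induction A rule: infinite_finite_induct) (auto simp: cone_zero intro: cone_add)

lemma cone_infnorm_le_iff: "v \<in> diag_cone t \<Longrightarrow> infnorm v \<le> c \<longleftrightarrow> v $ 1 \<le> c \<and> v $ 2 \<le> c"
  by (auto simp: infnorm_le_iff diag_cone_def)

definition vol :: "real^2 \<Rightarrow> real" where
  "vol v = v $ 1 + v $ 2"

lemma vol_add: "vol (v + w) = vol v + vol w"
  by (simp add: vol_def)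

lemma vol_sum: "vol (sum g A) = (\<Sum>i\<in>A. vol (g i))"
  by (simp add: vol_def sum.distrib)

lemma vol_nonneg: "v \<in> diag_cone t \<Longrightarrow> 0 \<le> vol v"
  by (simp add: diag_cone_def vol_def)

text \<open>Some coordinate exceeds \<open>c\<close>, and the cone forces the other one to be at
  least \<open>t\<close> times as large.\<close>

lemma vol_gt:
  assumes "v \<in> diag_cone t" "0 \<le> t" "\<not> infnorm v \<le> c"
  shows "(1 + t) * c < vol v"
proof -
  from assms(1,3) consider "c < v $ 1" | "c < v $ 2"
    by (auto simp: cone_infnorm_le_iff)
  then show ?thesis
  proof cases
    case 1
    then have "t * c \<le> t * v $ 1" using assms(2) by (simp add: mult_left_mono)
    then show ?thesis using 1 assms(1) by (simp add: diag_cone_def vol_def algebra_simps)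
  next
    case 2
    then have "t * c \<le> t * v $ 2" using assms(2) by (simp add: mult_left_mono)
    then show ?thesis using 2 assms(1) by (simp add: diag_cone_def vol_def algebra_simps)
  qed
qed

text \<open>In polar form the two slanted inequalities are sin(\<phi> - a) \<ge> 0 and cos(\<phi> +
  a) \<ge> 0, each expanded and divided by cos a > 0.\<close>

lemma cone_if_angle:
  assumes "v \<in> cbox 0 1" "angle v \<in> {a..pi/2 - a}" "0 \<le> a" "a \<le> pi/4"
  shows "v \<in> diag_cone (tan a)"
proof -
  define z where "z = Complex (v $ 1) (v $ 2)"
  define r where "r = cmod z"
  define \<phi> where "\<phi> = Arg z"
  have "z = rcis r \<phi>" by (simp add: r_def \<phi>_def rcis_cmod_Arg)
  then have xy: "v $ 1 = r * cos \<phi>" "v $ 2 = r * sin \<phi>"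
    by (simp_all add: z_def complex_eq_iff)
  have \<phi>: "a \<le> \<phi>" "\<phi> \<le> pi/2 - a" using assms(2) by (auto simp: angle_def \<phi>_def z_def)
  have pos: "0 < cos a" using assms(3,4) pi_gt_zero by (intro cos_gt_zero_pi) linarith+
  have r: "0 \<le> r" by (simp add: r_def)
  have "0 \<le> sin (\<phi> - a)" using \<phi> assms by (intro sin_ge_zero) auto
  then have 1: "tan a * cos \<phi> \<le> sin \<phi>"
    using pos by (simp add: sin_diff tan_def field_simps)
  have "0 \<le> cos (\<phi> + a)" using \<phi> assms by (intro cos_ge_zero) auto
  then have 2: "tan a * sin \<phi> \<le> cos \<phi>"
    using pos by (simp add: cos_add tan_def field_simps)
  have "0 \<le> v $ 1" "0 \<le> v $ 2" using assms(1) by (auto simp: mem_box_cart)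
  moreover have "tan a * v $ 1 \<le> v $ 2"
    using mult_left_mono[OF 1 r] by (simp add: xy mult_ac)
  moreover have "tan a * v $ 2 \<le> v $ 1"
    using mult_left_mono[OF 2 r] by (simp add: xy mult_ac)
  ultimately show ?thesis by (simp add: diag_cone_def)
qed

section \<open>Lower bounds on the optimum\<close>

text \<open>Group the sum by the bins of an optimal packing: each bin contributes at most
  \<open>c\<close>. Used with \<open>vol\<close> and with \<open>weight\<close>.\<close>

lemma sum_le_opt:
  fixes g :: "real^2 \<Rightarrow> real"
  assumes "set \<sigma> \<subseteq> cbox 0 1"
    and "\<And>I. I \<subseteq> {..<length \<sigma>} \<Longrightarrow> infnorm (\<Sum>i\<in>I. \<sigma> ! i) \<le> 1 \<Longrightarrow> (\<Sum>i\<in>I. g (\<sigma> ! i)) \<le> c"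
  shows "(\<Sum>i<length \<sigma>. g (\<sigma> ! i)) \<le> c * real (opt \<sigma>)"
proof -
  obtain q where q: "feasible_packing \<sigma> q" "num_bins q = opt \<sigma>"
    using opt_attained[OF assms(1)] by blast
  have len: "length q = length \<sigma>" using q(1) by (simp add: feasible_packing_def)
  have "(\<Sum>i<length \<sigma>. g (\<sigma> ! i)) =
      (\<Sum>k\<in>set q. \<Sum>i\<in>{i\<in>{..<length \<sigma>}. q ! i = k}. g (\<sigma> ! i))"
    by (rule sum.group[symmetric]) (auto simp: len[symmetric])
  also have "\<dots> \<le> (\<Sum>k\<in>set q. c)"
  proof (rule sum_mono)
    fix k
    have "infnorm (\<Sum>i\<in>{i\<in>{..<length \<sigma>}. q ! i = k}. \<sigma> ! i) \<le> 1"
      using q(1) by (simp add: feasible_packing_def)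
    then show "(\<Sum>i\<in>{i\<in>{..<length \<sigma>}. q ! i = k}. g (\<sigma> ! i)) \<le> c"
      by (intro assms(2)) auto
  qed
  also have "\<dots> = c * real (opt \<sigma>)"
    using q(2) by (simp add: num_bins_def)
  finally show ?thesis .
qed

lemma vol_le_opt:
  assumes "set \<sigma> \<subseteq> cbox 0 1"
  shows "(\<Sum>i<length \<sigma>. vol (\<sigma> ! i)) \<le> 2 * real (opt \<sigma>)"
proof (rule sum_le_opt[OF assms])
  fix I assume "infnorm (\<Sum>i\<in>I. \<sigma> ! i) \<le> 1"
  then have "vol (\<Sum>i\<in>I. \<sigma> ! i) \<le> 2"
    unfolding infnorm_le_iff vol_def by linarith
  then show "(\<Sum>i\<in>I. vol (\<sigma> ! i)) \<le> 2" by (simp add: vol_sum)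
qed

section \<open>Weights and the lower bound they give on the optimum\<close>

definition weight :: "real^2 \<Rightarrow> real" where
  "weight v = (if infnorm v \<le> 1/3 then 0 else if infnorm v \<le> 1/2 then 1/2 else 1)"

lemma weight_nonneg: "0 \<le> weight v"
  by (simp add: weight_def)

lemma weight_bin_le:
  fixes g :: "nat \<Rightarrow> real^2"
  assumes fin: "finite I" and mem_cone: "\<And>i. i \<in> I \<Longrightarrow> g i \<in> diag_cone t"
    and t: "1/3 < t" and feas: "infnorm (\<Sum>i\<in>I. g i) \<le> 1"
  shows "(\<Sum>i\<in>I. weight (g i)) \<le> 2"
proof -
  define B where "B = {i\<in>I. \<not> infnorm (g i) \<le> 1/2}"
  define D where "D = {i\<in>I. \<not> infnorm (g i) \<le> 1/3 \<and> infnorm (g i) \<le> 1/2}"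
  have finBD: "finite B" "finite D" using fin by (auto simp: B_def D_def)
  have disj: "B \<inter> D = {}" by (auto simp: B_def D_def)
  have sub: "B \<union> D \<subseteq> I" by (auto simp: B_def D_def)
  have W: "(\<Sum>i\<in>I. weight (g i)) = card B + card D / 2"
  proof -
    have "(\<Sum>i\<in>I. weight (g i)) = (\<Sum>i\<in>B \<union> D. weight (g i))"
      by (rule sum.mono_neutral_right) (use fin in \<open>auto simp: B_def D_def weight_def\<close>)
    also have "\<dots> = (\<Sum>i\<in>B. weight (g i)) + (\<Sum>i\<in>D. weight (g i))"
      by (rule sum.union_disjoint) (use finBD disj in auto)
    also have "(\<Sum>i\<in>B. weight (g i)) = (\<Sum>i\<in>B. 1)"
    proof (rule sum.cong)
      fix i assume "i \<in> B"
      then have *: "\<not> infnorm (g i) \<le> 1/2" by (simp add: B_def)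
      then have "\<not> infnorm (g i) \<le> 1/3" by linarith
      with * show "weight (g i) = 1" by (simp add: weight_def)
    qed simp
    also have "(\<Sum>i\<in>D. weight (g i)) = (\<Sum>i\<in>D. 1/2)"
      by (rule sum.cong) (auto simp: D_def weight_def)
    finally show ?thesis by simp
  qed
  have coord: "(\<Sum>i\<in>J. g i) $ c \<le> 1" if "J \<subseteq> I" for J c
  proof -
    have "(\<Sum>i\<in>J. g i $ c) \<le> (\<Sum>i\<in>I. g i $ c)"
      using fin that mem_cone exhaust_2[of c] by (intro sum_mono2) (auto simp: diag_cone_def)
    also have "\<dots> \<le> 1"
      using feas exhaust_2[of c] by (auto simp: infnorm_le_iff)
    finally show ?thesis by simp
  qed
  \<comment> \<open>Since 1 + t > 4/3, norm above 1/2 means volume above 2/3, and norm above 1/3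
    means volume above 4/9.\<close>
  have vlt: "2/3 * card B + 4/9 * card D < 2" if "B \<union> D \<noteq> {}"
  proof -
    have "2/3 * card B + 4/9 * card D = (\<Sum>i\<in>B \<union> D. if i \<in> B then 2/3 else 4/9 :: real)"
    proof -
      have "(\<Sum>i\<in>D. if i \<in> B then 2/3 else 4/9 :: real) = (\<Sum>i\<in>D. 4/9)"
        using disj by (intro sum.cong) auto
      then show ?thesis using disj finBD by (simp add: sum.union_disjoint)
    qed
    also have "\<dots> < (\<Sum>i\<in>B \<union> D. vol (g i))"
    proof (rule sum_strict_mono)
      fix i assume i: "i \<in> B \<union> D"
      show "(if i \<in> B then 2/3 else 4/9) < vol (g i)"
        using vol_gt[of "g i" t "1/2"] vol_gt[of "g i" t "1/3"] i mem_cone t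
        by (auto simp: B_def D_def)
    qed (use that finBD in auto)
    also have "\<dots> = (\<Sum>i\<in>B \<union> D. g i) $ 1 + (\<Sum>i\<in>B \<union> D. g i) $ 2"
      by (simp add: vol_def sum.distrib)
    also have "\<dots> \<le> 2" using coord[OF sub, of 1] coord[OF sub, of 2] by simp
    finally show ?thesis .
  qed
  \<comment> \<open>Volume alone does not rule out two large vectors and one of medium size.\<close>
  have no21: "D = {}" if two: "2 \<le> card B"
  proof (rule ccontr)
    assume "D \<noteq> {}"
    then obtain l where l: "l \<in> D" by blast
    have "\<not> card B \<le> Suc 0" using two by simp
    then obtain i j where ij: "i \<in> B" "j \<in> B" "i \<noteq> j"
      unfolding card_le_Suc0_iff_eq[OF finBD(1)] by blast
    have "l \<noteq> i" "l \<noteq> j" using l ij disj by auto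
    then have c: "g i $ c + g j $ c + g l $ c \<le> 1" for c
      using coord[of "{i,j,l}" c] l ij sub by (auto simp: add.assoc)
    have mem: "g i \<in> diag_cone t" "g j \<in> diag_cone t" "g l \<in> diag_cone t"
      using l ij by (auto simp: B_def D_def intro: mem_cone)
    have tb: "1/3 * x \<le> t * x" if "0 \<le> x" for x
      using t that by (intro mult_right_mono) auto
    have "g m $ 1 > 1/2 \<or> g m $ 2 > 1/2" if "m \<in> B" for m
      using that cone_infnorm_le_iff[OF mem_cone[of m], of "1/2"] by (auto simp: B_def not_le)
    with ij have "g i $ 1 > 1/2 \<or> g i $ 2 > 1/2" "g j $ 1 > 1/2 \<or> g j $ 2 > 1/2" by auto
    moreover have "g l $ 1 > 1/3 \<or> g l $ 2 > 1/3"
      using l cone_infnorm_le_iff[OF mem(3), of "1/3"] by (auto simp: D_def not_le)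
    \<comment> \<open>The two large vectors cannot exceed 1/2 in the same coordinate, so each
      coordinate has one of them above 1/2 and the other above 1/6, as t > 1/3. Less than 1/3 is
      left in either coordinate for \<open>g l\<close>.\<close>
    ultimately show False
      using c[of 1] c[of 2] mem tb[of "g i $ 1"] tb[of "g i $ 2"] tb[of "g j $ 1"] tb[of "g j $ 2"]
      unfolding diag_cone_def mem_Collect_eq by linarith
  qed
  \<comment> \<open>Among integer pairs (\<open>card B\<close>, \<open>card D\<close>) obeying the
    volume bound, only (2, 1) would violate this, and \<open>no21\<close> excludes it.\<close>
  have "2 * card B + card D \<le> 4"
  proof (cases "B \<union> D = {}")
    case False
    then have *: "6 * card B + 4 * card D < 18" using vlt by linarith
    show ?thesis
    proof (cases "2 \<le> card B")
      case True
      then have "card D = 0" using no21 by simp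
      with * show ?thesis by presburger
    next
      case 2: False
      with * show ?thesis by presburger
    qed
  qed simp
  then have "real (2 * card B + card D) \<le> real 4" by (rule of_nat_mono)
  then show ?thesis using W by simp
qed

lemma weight_le_opt:
  assumes "set \<sigma> \<subseteq> cbox 0 1" "set \<sigma> \<subseteq> diag_cone t" "1/3 < t"
  shows "(\<Sum>i<length \<sigma>. weight (\<sigma> ! i)) \<le> 2 * real (opt \<sigma>)"
proof (rule sum_le_opt[OF assms(1)])
  fix I assume I: "I \<subseteq> {..<length \<sigma>}" "infnorm (\<Sum>i\<in>I. \<sigma> ! i) \<le> 1"
  show "(\<Sum>i\<in>I. weight (\<sigma> ! i)) \<le> 2"
  proof (rule weight_bin_le)
    show "finite I" using I finite_subset by blast
    show "\<sigma> ! i \<in> diag_cone t" if "i \<in> I" for i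
      using that I assms(2) nth_mem by blast
  qed (use assms I in auto)
qed

section \<open>First fit with reservations\<close>

text \<open>
  The bins \<open>0, \<dots>, N - 1\<close> each reserve \<open>2/3\<close> of their capacity for one critical vector; the
  critical vectors fill these bins in order of arrival.
\<close>

function reserving_fit :: "(real^2 \<Rightarrow> bool) \<Rightarrow> nat \<Rightarrow> (nat \<Rightarrow> real^2) \<Rightarrow> nat \<Rightarrow> nat" where
  "reserving_fit crit N f i =
    (if crit (f i) then card {j. j < i \<and> crit (f j)}
     else LEAST k. infnorm ((\<Sum>j<i. if reserving_fit crit N f j = k \<and> \<not> crit (f j) then f j else 0) + f i)
       \<le> (if k < N then 1/3 else 1))"
  by pat_completeness auto
termination
  by (relation "Wellfounded.measure (\<lambda>(crit, N, f, i). i)") auto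

declare reserving_fit.simps [simp del]

text \<open>The rule is online: the bin of item \<open>i\<close> depends only on the items up to
  \<open>i\<close>. Hence decisions made on a revealed prefix agree with those computed from the
  whole input.\<close>

lemma reserving_fit_cong:
  "(\<And>j. j \<le> i \<Longrightarrow> f j = g j) \<Longrightarrow> reserving_fit crit N f i = reserving_fit crit N g i"
proof (induction i rule: less_induct)
  case (less i)
  have IH: "reserving_fit crit N f j = reserving_fit crit N g j" if "j < i" for j
    using that less.prems by (intro less.IH) auto
  have "(\<Sum>j<i. if reserving_fit crit N f j = k \<and> \<not> crit (f j) then f j else 0) =
      (\<Sum>j<i. if reserving_fit crit N g j = k \<and> \<not> crit (g j) then g j else 0)" for k
    using IH less.prems by (intro sum.cong) auto
  moreover have "{j. j < i \<and> crit (f j)} = {j. j < i \<and> crit (g j)}"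
    using less.prems by auto
  ultimately show ?case
    by (subst (1 2) reserving_fit.simps) (simp add: less.prems)
qed

text \<open>At most one index can have a value below \<open>c\<close>; drop it and use that its
  value is nonnegative.\<close>

lemma sum_all_but_one:
  fixes a :: "'a \<Rightarrow> real"
  assumes "finite A" "0 \<le> c" "\<And>k. k \<in> A \<Longrightarrow> 0 \<le> a k"
    and "\<And>k l. k \<in> A \<Longrightarrow> l \<in> A \<Longrightarrow> k \<noteq> l \<Longrightarrow> c \<le> a k \<or> c \<le> a l"
  shows "(real (card A) - 1) * c \<le> sum a A"
proof (cases "\<forall>k\<in>A. c \<le> a k")
  case True
  then have "real (card A) * c \<le> sum a A" using sum_bounded_below[of A c a] by auto
  then show ?thesis using assms(2) by (simp add: algebra_simps)
next
  case False
  then obtain k where k: "k \<in> A" "\<not> c \<le> a k" by blast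
  have "real (card (A - {k})) * c \<le> sum a (A - {k})"
    using assms(4) k by (intro sum_bounded_below) blast
  moreover have "sum a A = a k + sum a (A - {k})" using assms(1) k(1) by (rule sum.remove)
  moreover have "real (card (A - {k})) = real (card A) - 1"
    using card.remove[OF assms(1) k(1)] by simp
  ultimately show ?thesis using assms(3)[OF k(1)] by simp
qed

text \<open>\<open>crit\<close> stays abstract so that the construction serves twice: if no vector
  is critical, then \<open>N = 0\<close> and the packing is plain first fit. The bound 2/3 lets a
  critical vector join the 1/3 of a bin that is open to the others.\<close>

locale reserving =
  fixes t :: real and crit :: "real^2 \<Rightarrow> bool" and f :: "nat \<Rightarrow> real^2" and n N :: nat
  assumes t_nonneg: "0 \<le> t"
    and item_cone: "\<And>i. i < n \<Longrightarrow> f i \<in> diag_cone t"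
    and item_le: "\<And>i. i < n \<Longrightarrow> infnorm (f i) \<le> 1"
    and crit_le: "\<And>v. crit v \<Longrightarrow> infnorm v \<le> 2/3"
    and N_eq: "N = card {i. i < n \<and> crit (f i)}"
begin

section \<open>Structure and feasibility of the packing\<close>

definition p :: "nat \<Rightarrow> nat" where
  "p = reserving_fit crit N f"

definition cap :: "nat \<Rightarrow> real" where
  "cap k = (if k < N then 1/3 else 1)"

definition content :: "nat \<Rightarrow> nat \<Rightarrow> nat set" where
  "content i k = {j. j < i \<and> p j = k \<and> \<not> crit (f j)}"

definition load :: "nat \<Rightarrow> real^2" where
  "load k = (\<Sum>j\<in>content n k. f j)"

definition K :: "nat set" where
  "K = {k \<in> p ` {..<n}. N \<le> k}"

lemma finite_content [simp]: "finite (content i k)"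
  by (simp add: content_def)

lemma finite_K [simp]: "finite K"
  by (simp add: K_def)

lemma content_cone: "i \<le> n \<Longrightarrow> j \<in> content i k \<Longrightarrow> f j \<in> diag_cone t"
  by (auto simp: content_def intro: item_cone)

lemma load_cone: "load k \<in> diag_cone t"
  unfolding load_def by (intro cone_sum content_cone[of n]) auto

lemma p_crit: "crit (f i) \<Longrightarrow> p i = card {j. j < i \<and> crit (f j)}"
  by (simp add: p_def reserving_fit.simps)

lemma p_crit_less:
  assumes "i < n" "crit (f i)"
  shows "p i < N"
proof -
  have "p i < card {i. i < n \<and> crit (f i)}"
    unfolding p_crit[OF assms(2)] using assms by (intro psubset_card_mono) auto
  then show ?thesis by (simp add: N_eq[symmetric])
qed

lemma p_crit_inj:
  assumes "crit (f i)" "crit (f j)" "p i = p j"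
  shows "i = j"
proof -
  have "p i < p j" if "i < j" "crit (f i)" "crit (f j)" for i j
    unfolding p_crit[OF that(2)] p_crit[OF that(3)] using that
    by (intro psubset_card_mono) auto
  then show ?thesis using assms by (metis less_irrefl nat_neq_iff)
qed

lemma p_noncrit:
  assumes "\<not> crit (f i)"
  shows "p i = (LEAST k. infnorm ((\<Sum>j\<in>content i k. f j) + f i) \<le> cap k)"
proof -
  have "(\<Sum>j<i. if p j = k \<and> \<not> crit (f j) then f j else 0) = (\<Sum>j\<in>content i k. f j)" for k
  proof -
    have "content i k = {..<i} \<inter> {j. p j = k \<and> \<not> crit (f j)}"
      by (auto simp: content_def)
    then show ?thesis by (simp add: sum.inter_restrict)
  qed
  then show ?thesis
    using assms by (simp add: p_def reserving_fit.simps[of crit N f i] cap_def)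
qed

text \<open>The \<open>LEAST\<close> is attained: a label above \<open>N\<close> and above all
  labels used so far denotes an empty bin of capacity 1.\<close>

lemma p_fits:
  assumes "i < n" "\<not> crit (f i)"
  shows "infnorm ((\<Sum>j\<in>content i (p i). f j) + f i) \<le> cap (p i)"
proof -
  \<comment> \<open>The inserted 0 keeps \<open>Max\<close> meaningful when
    \<open>i = 0\<close>.\<close>
  define k where "k = Suc (N + Max (insert 0 (p ` {..<i})))"
  have "p j < k" if "j < i" for j
  proof -
    have "p j \<le> Max (insert 0 (p ` {..<i}))" using that by (intro Max_ge) auto
    then show ?thesis by (simp add: k_def)
  qed
  then have "content i k = {}" by (force simp: content_def)
  then have "infnorm ((\<Sum>j\<in>content i k. f j) + f i) \<le> cap k"
    using item_le[OF assms(1)] by (simp add: cap_def k_def)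
  then show ?thesis unfolding p_noncrit[OF assms(2)] by (rule LeastI)
qed

text \<open>The last noncritical item of the bin was tested together with all the earlier
  ones.\<close>

lemma load_le_cap: "infnorm (load k) \<le> cap k"
proof (cases "content n k = {}")
  case True
  then show ?thesis by (simp add: load_def cap_def infnorm_0)
next
  case False
  define i where "i = Max (content n k)"
  have i: "i \<in> content n k" using False by (simp add: i_def)
  have "content n k = insert i (content i k)"
  proof
    show "content n k \<subseteq> insert i (content i k)"
    proof
      fix j assume j: "j \<in> content n k"
      then have "j \<le> i" by (simp add: i_def)
      then show "j \<in> insert i (content i k)" using j by (auto simp: content_def)
    qed
  qed (use i in \<open>auto simp: content_def\<close>)
  moreover have "i \<notin> content i k" by (simp add: content_def)
  ultimately have "load k = (\<Sum>j\<in>content i k. f j) + f i"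
    by (simp add: load_def add.commute)
  then show ?thesis using p_fits[of i] i by (auto simp: content_def)
qed

text \<open>The item did not fit when it arrived, and adding nonnegative vectors afterwards only
  increases the load. This turns the online test into a statement about final loads.\<close>

lemma not_fits:
  assumes "i < n" "\<not> crit (f i)" "k < p i"
  shows "\<not> infnorm (load k + f i) \<le> cap k"
proof -
  have "\<not> infnorm ((\<Sum>j\<in>content i k. f j) + f i) \<le> cap k"
    using assms(3) unfolding p_noncrit[OF assms(2)] by (rule not_less_Least)
  moreover have "load k = (\<Sum>j\<in>content i k. f j) + (\<Sum>j\<in>content n k - content i k. f j)"
    unfolding load_def using assms(1)
    by (subst sum.subset_diff[of "content i k"]) (auto simp: content_def add.commute)
  moreover have "(\<Sum>j\<in>content n k - content i k. f j) \<in> diag_cone t"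
    by (intro cone_sum content_cone[of n]) auto
  moreover have "(\<Sum>j\<in>content i k. f j) \<in> diag_cone t"
    using assms(1) by (intro cone_sum content_cone[of i]) auto
  ultimately show ?thesis
    using item_cone[OF assms(1)] by (auto simp: diag_cone_def infnorm_le_iff)
qed

lemma vol_content_le: "j \<in> content n k \<Longrightarrow> vol (f j) \<le> vol (load k)"
  unfolding load_def vol_sum
  by (rule member_le_sum) (auto intro: vol_nonneg content_cone[of n])

text \<open>Any item of the later bin \<open>l\<close> was refused by \<open>k\<close>, so with the
  load of \<open>k\<close> it has norm above \<open>cap k\<close>; its own volume is part of that of
  \<open>l\<close>.\<close>

lemma vol_pair:
  assumes "k < l" "content n l \<noteq> {}"
  shows "(1 + t) * cap k < vol (load k) + vol (load l)"
proof -
  obtain j where j: "j \<in> content n l" using assms(2) by blast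
  then have *: "j < n" "\<not> crit (f j)" "k < p j" using assms(1) by (auto simp: content_def)
  have "(1 + t) * cap k < vol (load k + f j)"
    using not_fits[OF *] cone_add[OF load_cone item_cone[OF *(1)]] t_nonneg
    by (intro vol_gt)
  then show ?thesis using vol_content_le[OF j] by (simp add: vol_add)
qed

text \<open>Critical vectors receive distinct labels below \<open>N\<close>, so a bin holds at most
  one of them, next to a load of norm at most 1/3.\<close>

lemma bin_feasible: "infnorm (\<Sum>i | i < n \<and> p i = k. f i) \<le> 1"
proof -
  define Cr where "Cr = {i. i < n \<and> p i = k \<and> crit (f i)}"
  have "{i. i < n \<and> p i = k} = content n k \<union> Cr" "content n k \<inter> Cr = {}"
    by (auto simp: content_def Cr_def)
  then have eq: "(\<Sum>i | i < n \<and> p i = k. f i) = load k + (\<Sum>i\<in>Cr. f i)"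
    by (simp add: load_def sum.union_disjoint Cr_def)
  show ?thesis
  proof (cases "Cr = {}")
    case True
    have "cap k \<le> 1" by (simp add: cap_def)
    then show ?thesis using load_le_cap[of k] True eq by simp
  next
    case False
    then obtain i where i: "i \<in> Cr" by blast
    then have "Cr = {i}" using p_crit_inj by (auto simp: Cr_def)
    moreover have "k < N" "crit (f i)" using i p_crit_less by (auto simp: Cr_def)
    ultimately show ?thesis
      using load_le_cap[of k] crit_le[of "f i"] infnorm_triangle[of "load k" "f i"]
      unfolding eq by (simp add: cap_def)
  qed
qed

section \<open>Splitting sums over the bins, and the volume bound for plain first fit\<close>

lemma K_content: "k \<in> K \<Longrightarrow> content n k \<noteq> {}"
  using p_crit_less by (force simp: K_def content_def)

lemma card_bins_le: "card (p ` {..<n}) \<le> N + card K"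
proof -
  have "p ` {..<n} \<subseteq> {..<N} \<union> K" by (auto simp: K_def)
  then have "card (p ` {..<n}) \<le> card ({..<N} \<union> K)" by (intro card_mono) auto
  also have "\<dots> \<le> N + card K" using card_Un_le[of "{..<N}" K] by simp
  finally show ?thesis .
qed

lemma sum_split:
  fixes g :: "real^2 \<Rightarrow> real"
  shows "(\<Sum>i<n. g (f i)) = (\<Sum>i | i < n \<and> crit (f i). g (f i))
    + (\<Sum>k<N. \<Sum>i\<in>content n k. g (f i)) + (\<Sum>k\<in>K. \<Sum>i\<in>content n k. g (f i))"
proof -
  have 1: "(\<Sum>i<n. g (f i)) =
      (\<Sum>i | i < n \<and> crit (f i). g (f i)) + (\<Sum>i | i < n \<and> \<not> crit (f i). g (f i))"
    by (subst sum.union_disjoint[symmetric]) (auto intro!: sum.cong)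
  have "(\<Sum>i | i < n \<and> \<not> crit (f i). g (f i)) =
      (\<Sum>k\<in>{..<N} \<union> K. \<Sum>i\<in>{i\<in>{i. i < n \<and> \<not> crit (f i)}. p i = k}. g (f i))"
    by (rule sum.group[symmetric]) (auto simp: K_def)
  also have "\<dots> = (\<Sum>k\<in>{..<N} \<union> K. \<Sum>i\<in>content n k. g (f i))"
    by (intro sum.cong) (auto simp: content_def)
  also have "\<dots> = (\<Sum>k<N. \<Sum>i\<in>content n k. g (f i)) + (\<Sum>k\<in>K. \<Sum>i\<in>content n k. g (f i))"
    by (rule sum.union_disjoint) (auto simp: K_def)
  finally show ?thesis using 1 by simp
qed

lemma vol_split:
  "(\<Sum>i<n. vol (f i)) =
    (\<Sum>i | i < n \<and> crit (f i). vol (f i)) + (\<Sum>k<N. vol (load k)) + (\<Sum>k\<in>K. vol (load k))"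
  using sum_split[of vol] by (simp add: load_def vol_sum)

lemma plain_bins_le:
  assumes "\<And>v. \<not> crit v"
  shows "(real (card (p ` {..<n})) - 1) * ((1 + t) / 2) \<le> (\<Sum>i<n. vol (f i))"
proof -
  have N0: "N = 0" using assms by (simp add: N_eq)
  then have "N \<le> k" for k by simp
  then have K: "K = p ` {..<n}" by (auto simp: K_def)
  have "(real (card K) - 1) * ((1 + t) / 2) \<le> (\<Sum>k\<in>K. vol (load k))"
  proof (rule sum_all_but_one)
    fix k l assume "k \<in> K" "l \<in> K" "k \<noteq> l"
    moreover have "\<not> j < N" for j using N0 by simp
    then have "cap j = 1" for j by (simp add: cap_def)
    ultimately have "1 + t < vol (load k) + vol (load l)"
      using vol_pair[of k l] vol_pair[of l k] K_content[of k] K_content[of l]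
      by (cases k l rule: linorder_cases) simp_all
    then show "(1 + t) / 2 \<le> vol (load k) \<or> (1 + t) / 2 \<le> vol (load l)"
      by (cases "(1 + t) / 2 \<le> vol (load k)") auto
  qed (use t_nonneg vol_nonneg load_cone in auto)
  then show ?thesis using vol_split N0 assms K by simp
qed

end

section \<open>Bin counts when the critical vectors have norm in (1/2, 2/3]\<close>

locale reserving_critical = reserving +
  assumes crit_iff: "crit v \<longleftrightarrow> \<not> infnorm v \<le> 1/2 \<and> infnorm v \<le> 2/3"
begin

lemma weight_crit: "crit v \<Longrightarrow> weight v = 1"
  by (auto simp: crit_iff weight_def)

text \<open>Every item in a bin of \<open>K\<close> has weight at least 1/2, so a bin of weight
  below 1 holds one vector of norm at most 1/2. First fit would have merged two such bins. The
  critical vectors pay for the bins below \<open>N\<close>.\<close>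

lemma bins_le_weight:
  assumes no_tiny: "\<And>i. i < n \<Longrightarrow> N \<le> p i \<Longrightarrow> \<not> infnorm (f i) \<le> 1/3"
  shows "real (N + card K) \<le> (\<Sum>i<n. weight (f i)) + 1"
proof -
  define w where "w k = (\<Sum>i\<in>content n k. weight (f i))" for k
  have half: "1/2 \<le> weight (f i)" if "i \<in> content n k" "k \<in> K" for i k
    using no_tiny[of i] that by (auto simp: weight_def content_def K_def)
  have single: "\<exists>i. content n k = {i} \<and> infnorm (f i) \<le> 1/2" if k: "k \<in> K" "\<not> 1 \<le> w k" for k
  proof -
    have "real (card (content n k)) * (1/2) \<le> w k"
      unfolding w_def by (rule sum_bounded_below) (rule half[OF _ k(1)])
    then have "card (content n k) < 2" using k(2) by linarith
    moreover have "card (content n k) \<noteq> 0" using K_content[OF k(1)] by simp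
    ultimately have "card (content n k) = 1" by linarith
    then obtain i where i: "content n k = {i}" by (rule card_1_singletonE)
    then have "\<not> 1 \<le> weight (f i)" using k(2) by (simp add: w_def)
    then have "infnorm (f i) \<le> 1/2" by (auto simp: weight_def split: if_splits)
    then show ?thesis using i by blast
  qed
  have "False" if kl: "k \<in> K" "l \<in> K" "k < l" "\<not> 1 \<le> w k" "\<not> 1 \<le> w l" for k l
  proof -
    obtain i j where ij: "content n k = {i}" "infnorm (f i) \<le> 1/2"
        "content n l = {j}" "infnorm (f j) \<le> 1/2"
      using single kl by meson
    have j: "j \<in> content n l" using ij by simp
    then have "\<not> infnorm (load k + f j) \<le> cap k"
      using kl(3) by (intro not_fits) (auto simp: content_def)
    moreover have "infnorm (load k + f j) \<le> 1"
      using infnorm_triangle[of "f i" "f j"] ij by (simp add: load_def)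
    ultimately show False using kl(1) by (simp add: cap_def K_def)
  qed
  then have "(real (card K) - 1) * 1 \<le> (\<Sum>k\<in>K. w k)"
    by (intro sum_all_but_one) (auto simp: w_def intro!: sum_nonneg weight_nonneg, metis nat_neq_iff)
  moreover have "(\<Sum>i | i < n \<and> crit (f i). weight (f i)) = real N"
    by (simp add: weight_crit N_eq)
  moreover have "0 \<le> (\<Sum>k<N. \<Sum>i\<in>content n k. weight (f i))"
    by (intro sum_nonneg weight_nonneg)
  ultimately show ?thesis using sum_split[of weight] by (simp add: w_def)
qed

text \<open>The first light bin has load of norm at most 2/3, so whatever it refused has norm above
  1/3. Hence the second light bin can hold only one vector. That vector and any vector of the third
  bin have norm at most 1/2, so they would have shared a bin.\<close>

lemma no_three_light:
  assumes "k \<in> K" "l \<in> K" "m \<in> K" "k < l" "l < m"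
    and light: "vol (load k) < 2/3 * (1 + t)" "vol (load l) < 2/3 * (1 + t)"
      "vol (load m) < 2/3 * (1 + t)"
  shows False
proof -
  have small: "infnorm (f i) \<le> 1/2" if "i \<in> content n j" "vol (load j) < 2/3 * (1 + t)" for i j
  proof (rule ccontr)
    assume "\<not> infnorm (f i) \<le> 1/2"
    moreover have i: "\<not> crit (f i)" "i < n" using that by (auto simp: content_def)
    \<comment> \<open>This is where the gap (1/2, 2/3] left by the critical vectors is used: such a
      vector alone would make its bin heavy.\<close>
    ultimately have "\<not> infnorm (f i) \<le> 2/3" by (simp add: crit_iff)
    then have "(1 + t) * (2/3) < vol (f i)"
      using item_cone[OF i(2)] t_nonneg by (intro vol_gt)
    then show False using vol_content_le[OF that(1)] that(2) by linarith
  qed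
  have capK: "cap j = 1" if "j \<in> K" for j using that by (simp add: cap_def K_def)
  have "infnorm (load k) \<le> 2/3"
    using vol_gt[OF load_cone t_nonneg, of k "2/3"] light(1) by argo
  moreover have "\<not> infnorm (load k + f i) \<le> 1" if "i \<in> content n l" for i
    using not_fits[of i k] that assms(4) capK[OF assms(1)] by (auto simp: content_def)
  ultimately have third: "\<not> infnorm (f i) \<le> 1/3" if "i \<in> content n l" for i
    using that infnorm_triangle[of "load k" "f i"] by fastforce
  have volthird: "(1 + t) * (1/3) \<le> vol (f i)" if "i \<in> content n l" for i
    using vol_gt[OF content_cone[OF order.refl that] t_nonneg third[OF that]] by simp
  have "card (content n l) = 1"
  proof -
    have "real (card (content n l)) * ((1 + t) * (1/3)) \<le> vol (load l)"
      unfolding load_def vol_sum by (rule sum_bounded_below) (rule volthird)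
    also have "\<dots> < 2 * ((1 + t) * (1/3))" using light(2) by simp
    finally have "card (content n l) < 2" using t_nonneg
      by (subst (asm) mult_less_cancel_right_pos) auto
    moreover have "card (content n l) \<noteq> 0" using K_content[OF assms(2)] by simp
    ultimately show ?thesis by linarith
  qed
  then obtain i where i: "content n l = {i}" by (rule card_1_singletonE)
  obtain j where j: "j \<in> content n m" using K_content[OF assms(3)] by blast
  have "\<not> infnorm (load l + f j) \<le> 1"
    using not_fits[of j l] j assms(5) capK[OF assms(2)] by (auto simp: content_def)
  moreover have "load l = f i" by (simp add: load_def i)
  moreover have "infnorm (f i) \<le> 1/2" using small[of i l] i light(2) by simp
  moreover have "infnorm (f j) \<le> 1/2" using small[OF j light(3)] .
  ultimately show False using infnorm_triangle[of "f i" "f j"] by simp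
qed

text \<open>The target is 2\<theta> per bin, for all bins but one. A bin below \<open>N\<close> gets
  3/2 \<theta> from its critical vector and needs \<theta>/2 from its load; a bin of
  \<open>K\<close> needs the full 2\<theta>.\<close>

lemma bins_le_vol:
  assumes tiny: "i0 < n" "N \<le> p i0" "infnorm (f i0) \<le> 1/3"
  shows "(real (N + card K) - 1) * (2/3 * (1 + t)) \<le> (\<Sum>i<n. vol (f i))"
proof -
  define \<theta> where "\<theta> = (1 + t) / 3"
  have \<theta>: "0 \<le> \<theta>" using t_nonneg by (simp add: \<theta>_def)
  have nc0: "\<not> crit (f i0)" using tiny by (auto simp: crit_iff)
  have K0: "p i0 \<in> K" using tiny by (auto simp: K_def)
  \<comment> \<open>An empty bin below \<open>N\<close> would have accepted the tiny vector, since
    its capacity is 1/3.\<close>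
  have nonempty: "content n k \<noteq> {}" if "k < N" for k
  proof
    assume "content n k = {}"
    then have "load k = 0" by (simp add: load_def)
    moreover have "\<not> infnorm (load k + f i0) \<le> cap k"
      using tiny nc0 that by (intro not_fits) auto
    ultimately show False using tiny that by (simp add: cap_def)
  qed
  have pair: "\<theta> / 2 \<le> vol (load k) \<or> \<theta> / 2 \<le> vol (load l)"
    if "k < N \<or> k \<in> K" "l < N \<or> l \<in> K" "k \<noteq> l" for k l
  proof -
    have "\<theta> \<le> (1 + t) * cap j" for j
    proof -
      have "(1 + t) * (1/3) \<le> (1 + t) * cap j"
        using t_nonneg by (intro mult_left_mono) (auto simp: cap_def)
      then show ?thesis by (simp add: \<theta>_def)
    qed
    from this[of k] this[of l] have "\<theta> < vol (load k) + vol (load l)"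
      using vol_pair[of k l] vol_pair[of l k] nonempty[of k] nonempty[of l]
        K_content[of k] K_content[of l] that
      by (cases k l rule: linorder_cases) auto
    then show ?thesis by (cases "\<theta> / 2 \<le> vol (load k)") auto
  qed
  have vpos: "0 \<le> vol (load k)" for k using vol_nonneg load_cone by blast
  have critv: "real N * (3/2 * \<theta>) \<le> (\<Sum>i | i < n \<and> crit (f i). vol (f i))"
  proof -
    have "3/2 * \<theta> \<le> vol (f i)" if "i < n" "crit (f i)" for i
      using vol_gt[OF item_cone[OF that(1)] t_nonneg, of "1/2"] that
      by (simp add: crit_iff \<theta>_def)
    then show ?thesis unfolding N_eq by (intro sum_bounded_below) auto
  qed
  have "real (N + card K) * (2 * \<theta>) - 2 * \<theta> \<le>
      real N * (3/2 * \<theta>) + (\<Sum>k<N. vol (load k)) + (\<Sum>k\<in>K. vol (load k))"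
  proof (cases "\<exists>k l. k \<in> K \<and> l \<in> K \<and> k < l \<and> vol (load k) < 2 * \<theta> \<and> vol (load l) < 2 * \<theta>")
    case True
    then obtain k l where kl: "k \<in> K" "l \<in> K" "k < l" "vol (load k) < 2 * \<theta>" "vol (load l) < 2 * \<theta>"
      by blast
    have heavy: "2 * \<theta> \<le> vol (load m)" if "m \<in> K - {k, l}" for m
    proof (rule ccontr)
      assume m: "\<not> 2 * \<theta> \<le> vol (load m)"
      have "m \<noteq> k" "m \<noteq> l" using that by auto
      then consider "m < k" | "k < m" "m < l" | "l < m"
        by (cases m k rule: linorder_cases; cases m l rule: linorder_cases) auto
      then show False
        using no_three_light[of m k l] no_three_light[of k m l] no_three_light[of k l m] kl m that
        by cases (auto simp: \<theta>_def)
    qed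
    have ckl: "real (card (K - {k, l})) = real (card K) - 2"
    proof -
      have "card {k, l} \<le> card K" using kl by (intro card_mono) auto
      moreover have "card (K - {k, l}) = card K - card {k, l}"
        using kl by (intro card_Diff_subset) auto
      moreover have "card {k, l} = 2" using kl by simp
      ultimately show ?thesis by simp
    qed
    have "real (card (K - {k, l})) * (2 * \<theta>) \<le> (\<Sum>m\<in>K - {k, l}. vol (load m))"
      by (intro sum_bounded_below heavy)
    moreover have "(\<Sum>m\<in>K. vol (load m)) = (\<Sum>m\<in>K - {k, l}. vol (load m)) + (\<Sum>m\<in>{k, l}. vol (load m))"
      using kl by (intro sum.subset_diff) auto
    moreover have "(\<Sum>m\<in>{k, l}. vol (load m)) = vol (load k) + vol (load l)"
      using kl by simp
    \<comment> \<open>The two light bins together miss at most \<theta> of their 4\<theta>, and the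
      loads below \<open>N\<close> miss at most \<theta>/2. The total of 3/2 \<theta> stays within
      the 2\<theta> of the one bin that is not charged.\<close>
    moreover have "3 * \<theta> < vol (load k) + vol (load l)"
      using vol_pair[OF kl(3) K_content[OF kl(2)]] kl(1) by (simp add: cap_def K_def \<theta>_def)
    moreover have "(real (card {..<N}) - 1) * (\<theta> / 2) \<le> (\<Sum>k<N. vol (load k))"
      using \<theta> vpos pair by (intro sum_all_but_one) auto
    ultimately show ?thesis using \<theta> unfolding ckl by (simp add: algebra_simps)
  next
    case False
    \<comment> \<open>The only light bin of \<open>K\<close> if there is one, otherwise the bin of
      the overflowing tiny vector, as some member of \<open>K\<close>.\<close>
    define b where "b = (if \<exists>k\<in>K. vol (load k) < 2 * \<theta>
      then SOME k. k \<in> K \<and> vol (load k) < 2 * \<theta> else p i0)"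
    have b: "b \<in> K" "\<And>k. k \<in> K - {b} \<Longrightarrow> 2 * \<theta> \<le> vol (load k)"
    proof -
      have "b \<in> K \<and> (\<forall>k\<in>K - {b}. 2 * \<theta> \<le> vol (load k))"
      proof (cases "\<exists>k\<in>K. vol (load k) < 2 * \<theta>")
        case True
        then have "\<exists>k. k \<in> K \<and> vol (load k) < 2 * \<theta>" by blast
        then have *: "b \<in> K \<and> vol (load b) < 2 * \<theta>"
          unfolding b_def if_P[OF True] by (rule someI_ex)
        have "2 * \<theta> \<le> vol (load k)" if "k \<in> K - {b}" for k
        proof (rule ccontr)
          assume "\<not> 2 * \<theta> \<le> vol (load k)"
          moreover have "k < b \<or> b < k" using that by auto
          ultimately show False using False * that by (meson DiffD1 not_le)
        qed
        then show ?thesis using * by blast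
      next
        case F: False
        then have "b = p i0" by (simp add: b_def)
        then show ?thesis using K0 F by force
      qed
      then show "b \<in> K" "\<And>k. k \<in> K - {b} \<Longrightarrow> 2 * \<theta> \<le> vol (load k)" by blast+
    qed
    have bN: "b \<notin> {..<N}" using b(1) by (simp add: K_def)
    \<comment> \<open>Pooling \<open>b\<close> with the bins below \<open>N\<close> gives N + 1
      bins, so losing one of them still leaves \<theta>/2 for each of the N. Then \<open>b\<close>
      is the bin not charged.\<close>
    have "(real (card (insert b {..<N})) - 1) * (\<theta> / 2) \<le> (\<Sum>k\<in>insert b {..<N}. vol (load k))"
      using \<theta> vpos pair b(1) by (intro sum_all_but_one) auto
    then have 1: "real N * (\<theta> / 2) \<le> vol (load b) + (\<Sum>k<N. vol (load k))"
      using bN by simp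
    have "real (card (K - {b})) * (2 * \<theta>) \<le> (\<Sum>k\<in>K - {b}. vol (load k))"
      by (intro sum_bounded_below b(2))
    moreover have "real (card (K - {b})) = real (card K) - 1"
      using card.remove[OF finite_K b(1)] by simp
    moreover have "(\<Sum>k\<in>K. vol (load k)) = vol (load b) + (\<Sum>k\<in>K - {b}. vol (load k))"
      using b(1) by (intro sum.remove) auto
    ultimately show ?thesis using 1 by (simp add: algebra_simps)
  qed
  moreover have "(real (N + card K) - 1) * (2/3 * (1 + t)) = real (N + card K) * (2 * \<theta>) - 2 * \<theta>"
    by (simp add: \<theta>_def field_simps)
  ultimately show ?thesis using vol_split critv by linarith
qed

end

section \<open>Advice\<close>

text \<open>
  Digits of the bijective binary numeral of \<open>k\<close>, each preceded by a continuation bit, which makes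
  the encoding self-delimiting.
\<close>

fun code :: "nat \<Rightarrow> bool list" where
  "code 0 = [False]"
| "code (Suc k) = True # odd k # code (k div 2)"

text \<open>The first bit tells whether the number is 0, the second gives the parity of its
  predecessor, and the rest is handled by induction. Thus a reader can recognise the end of a
  codeword.\<close>

lemma code_prefix_free: "code k @ xs = code l \<Longrightarrow> xs = [] \<and> k = l"
proof (induction k arbitrary: l rule: code.induct)
  case 1
  then show ?case by (cases l) auto
next
  case (2 k)
  then obtain m where m: "l = Suc m" by (cases l) auto
  with 2 have "xs = [] \<and> k div 2 = m div 2" "odd k = odd m" by auto
  then show ?case using m by (metis odd_two_times_div_two_succ even_two_times_div_two)
qed

lemma inj_code: "inj code"
  by (rule injI) (metis append_Nil2 code_prefix_free)

text \<open>Each round costs two bits and at least halves the number plus one.\<close>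

lemma length_code: "real (length (code k)) \<le> 1 + 2 * log 2 (real k + 1)"
proof (induction k rule: code.induct)
  case (2 k)
  have "2 * (real (k div 2) + 1) \<le> real (Suc k) + 1"
    using of_nat_mono[of "2 * (k div 2)" k, where ?'a = real] by simp
  then have "log 2 (2 * (real (k div 2) + 1)) \<le> log 2 (real (Suc k) + 1)"
    by (subst log_le_cancel_iff) auto
  then have "1 + log 2 (real (k div 2) + 1) \<le> log 2 (real (Suc k) + 1)"
    by (subst (asm) log_mult) auto
  then show ?case using 2 by simp
qed simp

definition without_advice :: "((real^2) list \<Rightarrow> nat) \<Rightarrow> strategy" where
  "without_advice A \<sigma> bits = Place (A \<sigma>)"

definition with_advice :: "(nat \<Rightarrow> (real^2) list \<Rightarrow> nat) \<Rightarrow> strategy" where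
  "with_advice A \<sigma> bits = (if bits \<in> range code then Place (A (inv code bits) \<sigma>) else Read_Bit)"

definition outcome :: "((real^2) list \<Rightarrow> nat) \<Rightarrow> (real^2) list \<Rightarrow> nat list" where
  "outcome A \<sigma> = map (\<lambda>i. A (take (Suc i) \<sigma>)) [0..<length \<sigma>]"

lemma outcome_snoc: "outcome A (\<sigma> @ [v]) = outcome A \<sigma> @ [A (\<sigma> @ [v])]"
  by (simp add: outcome_def)

lemma run_without_advice: "run (without_advice A) tape \<sigma> (outcome A \<sigma>) 0"
proof (induction \<sigma> rule: rev_induct)
  case Nil
  then show ?case by (simp add: outcome_def run.start)
next
  case (snoc v \<sigma>)
  show ?case unfolding outcome_snoc
    by (rule run.step[OF snoc]) (auto intro!: serve.place simp: without_advice_def)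
qed

text \<open>No proper prefix of \<open>code k\<close> is a codeword, so the strategy reads exactly
  \<open>code k\<close> at the first vector and nothing later. The bound is not an equality because
  nothing is read on the empty input.\<close>

lemma run_with_advice:
  "\<exists>tape b. run (with_advice A) tape \<sigma> (outcome (A k) \<sigma>) b \<and> b \<le> length (code k)"
proof -
  \<comment> \<open>Beyond the end of \<open>code k\<close> the tape has unspecified bits, which are
    never read.\<close>
  define tape where "tape i = code k ! i" for i
  let ?l = "length (code k)"
  have tape: "map tape [0..<r] = take r (code k)" if "r \<le> ?l" for r
    using that by (intro nth_equalityI) (auto simp: tape_def)
  have full: "with_advice A \<tau> (map tape [0..<?l]) = Place (A k \<tau>)" for \<tau>
    by (simp add: tape with_advice_def inv_f_f[OF inj_code])
  have part: "with_advice A \<tau> (map tape [0..<r]) = Read_Bit" if "r < ?l" for \<tau> r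
  proof -
    have "take r (code k) \<notin> range code"
    proof
      assume "take r (code k) \<in> range code"
      then obtain l where "code l = take r (code k)" by auto
      then have "code l @ drop r (code k) = code k" by simp
      then have "drop r (code k) = []" using code_prefix_free by blast
      then show False using that by simp
    qed
    then show ?thesis using tape[of r] that by (simp add: with_advice_def)
  qed
  have serve: "serve (with_advice A) tape \<tau> r (A k \<tau>) ?l" if "r \<le> ?l" for \<tau> r
    using that
  proof (induction r rule: inc_induct)
    case base
    show ?case by (rule serve.place) (rule full)
  next
    case (step r)
    show ?case by (rule serve.read) (use step in \<open>auto intro: part\<close>)
  qed
  have "\<exists>b. run (with_advice A) tape \<sigma> (outcome (A k) \<sigma>) b \<and> b \<le> ?l"
  proof (induction \<sigma> rule: rev_induct)
    case Nil
    have "run (with_advice A) tape [] (outcome (A k) []) 0"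
      by (simp add: outcome_def run.start)
    then show ?case by blast
  next
    case (snoc v \<sigma>)
    then obtain b where "run (with_advice A) tape \<sigma> (outcome (A k) \<sigma>) b" "b \<le> ?l" by blast
    then have "run (with_advice A) tape (\<sigma> @ [v]) (outcome (A k) (\<sigma> @ [v])) ?l"
      unfolding outcome_snoc by (intro run.step[OF _ serve])
    then show ?case by blast
  qed
  then show ?thesis by blast
qed

section \<open>The two regimes\<close>

text \<open>The vector to be packed has index \<open>length \<sigma> - 1\<close>; the earlier
  decisions are recomputed by the recursion.\<close>

definition place_last :: "(real^2 \<Rightarrow> bool) \<Rightarrow> nat \<Rightarrow> (real^2) list \<Rightarrow> nat" where
  "place_last crit N \<sigma> = reserving_fit crit N ((!) \<sigma>) (length \<sigma> - 1)"

lemma outcome_place_last: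
  "outcome (place_last crit N) \<sigma> = map (reserving_fit crit N ((!) \<sigma>)) [0..<length \<sigma>]"
proof (unfold outcome_def, rule map_cong[OF refl])
  fix i assume "i \<in> set [0..<length \<sigma>]"
  then show "place_last crit N (take (Suc i) \<sigma>) = reserving_fit crit N ((!) \<sigma>) i"
    by (simp add: place_last_def min_absorb2) (rule reserving_fit_cong, simp)
qed

lemma reserving_packing:
  assumes "reserving t crit ((!) \<sigma>) (length \<sigma>) N"
  shows "feasible_packing \<sigma> (outcome (place_last crit N) \<sigma>)"
    and "num_bins (outcome (place_last crit N) \<sigma>) =
      card (reserving_fit crit N ((!) \<sigma>) ` {..<length \<sigma>})"
proof -
  interpret reserving t crit "(!) \<sigma>" "length \<sigma>" N by fact
  have eq: "{i. i < length \<sigma> \<and> outcome (place_last crit N) \<sigma> ! i = k} =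
      {i. i < length \<sigma> \<and> p i = k}" for k
    by (auto simp: outcome_place_last p_def)
  show "feasible_packing \<sigma> (outcome (place_last crit N) \<sigma>)"
    unfolding feasible_packing_def eq using bin_feasible by (simp add: outcome_def)
  show "num_bins (outcome (place_last crit N) \<sigma>) =
      card (reserving_fit crit N ((!) \<sigma>) ` {..<length \<sigma>})"
    by (simp add: num_bins_def outcome_place_last lessThan_atLeast0)
qed

lemma plain_first_fit:
  assumes \<sigma>: "set \<sigma> \<subseteq> cbox 0 1" "set \<sigma> \<subseteq> diag_cone t" and t: "0 \<le> t"
  defines "q \<equiv> outcome (place_last (\<lambda>_. False) 0) \<sigma>"
  shows "feasible_packing \<sigma> q" "real (num_bins q) \<le> 4 / (1 + t) * real (opt \<sigma>) + 1"
proof -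
  have r: "reserving t (\<lambda>_. False) ((!) \<sigma>) (length \<sigma>) 0"
    using \<sigma> t nth_mem by unfold_locales (auto intro!: infnorm_le_1)
  then show "feasible_packing \<sigma> q" unfolding q_def by (rule reserving_packing)
  have "(real (num_bins q) - 1) * ((1 + t) / 2) \<le> (\<Sum>i<length \<sigma>. vol (\<sigma> ! i))"
    using reserving.plain_bins_le[OF r] reserving_packing(2)[OF r]
    by (simp add: q_def reserving.p_def[OF r])
  also have "\<dots> \<le> 2 * real (opt \<sigma>)" by (rule vol_le_opt[OF \<sigma>(1)])
  finally show "real (num_bins q) \<le> 4 / (1 + t) * real (opt \<sigma>) + 1"
    using t by (simp add: field_simps)
qed

definition critical :: "real^2 \<Rightarrow> bool" where
  "critical v \<longleftrightarrow> \<not> infnorm v \<le> 1/2 \<and> infnorm v \<le> 2/3"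

lemma reserving_first_fit:
  assumes \<sigma>: "set \<sigma> \<subseteq> cbox 0 1" "set \<sigma> \<subseteq> diag_cone t" and t: "1/3 < t"
  defines "q \<equiv> outcome (place_last critical (card {i. i < length \<sigma> \<and> critical (\<sigma> ! i)})) \<sigma>"
  shows "feasible_packing \<sigma> q" "real (num_bins q) \<le> max 2 (3 / (1 + t)) * real (opt \<sigma>) + 1"
proof -
  define N where "N = card {i. i < length \<sigma> \<and> critical (\<sigma> ! i)}"
  have "reserving_critical t critical ((!) \<sigma>) (length \<sigma>) N"
    using \<sigma> t nth_mem by unfold_locales (auto intro!: infnorm_le_1 simp: critical_def N_def)
  then interpret reserving_critical t critical "(!) \<sigma>" "length \<sigma>" N .
  note pack = reserving_packing[OF reserving_axioms]
  show "feasible_packing \<sigma> q" unfolding q_def N_def[symmetric] by (rule pack)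
  have bins: "real (num_bins q) \<le> real (N + card K)"
    using card_bins_le pack(2) by (simp add: q_def N_def[symmetric] p_def)
  show "real (num_bins q) \<le> max 2 (3 / (1 + t)) * real (opt \<sigma>) + 1"
  \<comment> \<open>Overflow of a tiny vector decides whether volume or weight pays for the
    bins.\<close>
  proof (cases "\<exists>i < length \<sigma>. N \<le> p i \<and> infnorm (\<sigma> ! i) \<le> 1/3")
    case True
    then obtain i where "i < length \<sigma>" "N \<le> p i" "infnorm (\<sigma> ! i) \<le> 1/3" by blast
    from bins_le_vol[OF this] vol_le_opt[OF \<sigma>(1)]
    have "(real (N + card K) - 1) * (2/3 * (1 + t)) \<le> 2 * real (opt \<sigma>)" by linarith
    then have "real (N + card K) \<le> 3 / (1 + t) * real (opt \<sigma>) + 1"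
      using t by (simp add: field_simps)
    also have "3 / (1 + t) * real (opt \<sigma>) \<le> max 2 (3 / (1 + t)) * real (opt \<sigma>)"
      by (intro mult_right_mono) auto
    finally show ?thesis using bins by linarith
  next
    case False
    then have "real (N + card K) \<le> (\<Sum>i<length \<sigma>. weight (\<sigma> ! i)) + 1"
      by (intro bins_le_weight) blast
    also have "(\<Sum>i<length \<sigma>. weight (\<sigma> ! i)) \<le> 2 * real (opt \<sigma>)"
      by (rule weight_le_opt[OF \<sigma> t])
    also have "2 * real (opt \<sigma>) \<le> max 2 (3 / (1 + t)) * real (opt \<sigma>)"
      by (intro mult_right_mono) auto
    finally show ?thesis using bins by linarith
  qed
qed

text \<open>For n \<ge> 2 we have k + 1 \<le> n^2, so the length is at most 1 + 4 log n \<le> 5 log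
  n in base 2; the factor 10 follows from ln 2 \<ge> 1/2.\<close>

lemma advice_length_le:
  assumes "2 \<le> n" "k \<le> n"
  shows "real (length (code k)) \<le> 10 * ln (real n)"
proof -
  have "real k + 1 \<le> real n ^ 2"
  proof -
    have "2 * real n \<le> real n * real n" using assms by (intro mult_right_mono) auto
    then show ?thesis using assms unfolding power2_eq_square by linarith
  qed
  then have "log 2 (real k + 1) \<le> log 2 (real n ^ 2)"
    using assms by (subst log_le_cancel_iff) auto
  also have "\<dots> = 2 * log 2 (real n)" using assms by (simp add: log_nat_power)
  finally have "real (length (code k)) \<le> 1 + 4 * log 2 (real n)"
    using length_code[of k] by linarith
  also have "1 \<le> log 2 (real n)" using assms by (simp add: le_log_iff)
  also have "log 2 (real n) \<le> 2 * ln (real n)"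
  proof -
    have "1/2 \<le> ln (2 :: real)" using ln2_ge_two_thirds by simp
    moreover have "0 \<le> ln (real n)" using assms by simp
    ultimately have "ln (real n) * (1/2) \<le> ln (real n) * ln 2" by (intro mult_left_mono)
    then have "ln (real n) \<le> 2 * ln (real n) * ln 2"
      by simp
    then show ?thesis by (simp add: log_def field_simps)
  qed
  finally show ?thesis by simp
qed

theorem theorem2:
  shows "\<exists>C::real. \<forall>\<gamma> \<epsilon> :: real. 0 \<le> \<gamma> \<and> \<gamma> < pi / 3 \<and> 0 < \<epsilon> \<longrightarrow>
    (\<exists>S::strategy. \<forall>\<sigma>::(real^2) list.
       (\<forall>v\<in>set \<sigma>. v \<in> cbox 0 1 \<and> angle v \<in> {pi/4 - \<gamma>/2 .. pi/4 + \<gamma>/2}) \<longrightarrow>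
       (\<exists>tape p b. run S tape \<sigma> p b \<and> feasible_packing \<sigma> p \<and>
          (length \<sigma> \<ge> 2 \<longrightarrow> real b \<le> C * (1 / \<epsilon>) * ln (real (length \<sigma>))) \<and>
          real (num_bins p) \<le> max 2 (6 / (1 + 3 * tan (pi/4 - \<gamma>/2)) + \<epsilon>) * real (opt \<sigma>) + 1))"
proof (intro exI[where x = 40] allI impI, elim conjE)
  fix \<gamma> \<epsilon> :: real
  assume \<gamma>: "0 \<le> \<gamma>" "\<gamma> < pi / 3" and \<epsilon>: "0 < \<epsilon>"
  define a where "a = pi/4 - \<gamma>/2"
  define t where "t = tan a"
  let ?c = "max 2 (6 / (1 + 3 * t) + \<epsilon>)"
  let ?ok = "\<lambda>\<sigma>. set \<sigma> \<subseteq> cbox 0 1 \<and> set \<sigma> \<subseteq> diag_cone t"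
  have a: "0 < a" "a \<le> pi/4" using \<gamma> by (auto simp: a_def)
  then have t0: "0 \<le> t" unfolding t_def by (intro less_imp_le tan_gt_zero) auto
  have t1: "t \<le> 1"
    using tan_mono_le[of a "pi/4"] a by (simp add: t_def tan_45)
  have ok: "?ok \<sigma>" if "\<forall>v\<in>set \<sigma>. v \<in> cbox 0 1 \<and> angle v \<in> {pi/4 - \<gamma>/2 .. pi/4 + \<gamma>/2}" for \<sigma>
  proof -
    have "pi/4 + \<gamma>/2 = pi/2 - a" by (simp add: a_def)
    then have "v \<in> diag_cone t" if "v \<in> set \<sigma>" for v
      unfolding t_def using \<open>\<forall>v\<in>set \<sigma>. _ v\<close> that a by (intro cone_if_angle) (auto simp: a_def)
    then show ?thesis using that by blast
  qed
  have "\<exists>S. \<forall>\<sigma>. ?ok \<sigma> \<longrightarrow> (\<exists>tape p b. run S tape \<sigma> p b \<and> feasible_packing \<sigma> p \<and>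
      (length \<sigma> \<ge> 2 \<longrightarrow> real b \<le> 40 * (1 / \<epsilon>) * ln (real (length \<sigma>))) \<and>
      real (num_bins p) \<le> ?c * real (opt \<sigma>) + 1)"
  \<comment> \<open>The threshold 4 makes the constant 40 uniform in \<epsilon>: below it, 10 \<le>
    40/\<epsilon>, and from it on the ratio 4/(1 + t) \<le> 4 is reached without advice.\<close>
  proof (cases "4 \<le> \<epsilon> \<or> t \<le> 1/3")
    case True
    have ratio: "4 / (1 + t) \<le> ?c"
    proof (cases "4 \<le> \<epsilon>")
      case True
      have "4 / (1 + t) \<le> 4" using t0 by (simp add: field_simps)
      moreover have "0 \<le> 6 / (1 + 3 * t)" using t0 by simp
      ultimately show ?thesis using True by linarith
    next
      case False
      \<comment> \<open>Clearing denominators, this is exactly t \<le> 1/3.\<close>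
      then have "4 / (1 + t) \<le> 6 / (1 + 3 * t)" using True t0 by (simp add: field_simps)
      then show ?thesis using \<epsilon> by linarith
    qed
    let ?A = "place_last (\<lambda>_. False) 0"
    show ?thesis
    proof (intro exI[where x = "without_advice ?A"] allI impI)
      fix \<sigma> assume "?ok \<sigma>"
      then have \<sigma>: "set \<sigma> \<subseteq> cbox 0 1" "set \<sigma> \<subseteq> diag_cone t" by auto
      note q = plain_first_fit[OF \<sigma> t0]
      have "4 / (1 + t) * real (opt \<sigma>) \<le> ?c * real (opt \<sigma>)"
        by (rule mult_right_mono[OF ratio]) simp
      then have "real (num_bins (outcome ?A \<sigma>)) \<le> ?c * real (opt \<sigma>) + 1"
        using q(2) by linarith
      moreover have "length \<sigma> \<ge> 2 \<longrightarrow> real 0 \<le> 40 * (1 / \<epsilon>) * ln (real (length \<sigma>))"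
        using \<epsilon> by simp
      ultimately show "\<exists>tape p b. run (without_advice ?A) tape \<sigma> p b \<and> feasible_packing \<sigma> p \<and>
          (length \<sigma> \<ge> 2 \<longrightarrow> real b \<le> 40 * (1 / \<epsilon>) * ln (real (length \<sigma>))) \<and>
          real (num_bins p) \<le> ?c * real (opt \<sigma>) + 1"
        using run_without_advice q(1) by blast
    qed
  next
    case False
    then have t: "1/3 < t" and \<epsilon>4: "\<epsilon> < 4" by auto
    \<comment> \<open>Clearing denominators, this is exactly t \<le> 1.\<close>
    have "3 / (1 + t) \<le> 6 / (1 + 3 * t)" using t0 t1 by (simp add: field_simps)
    then have ratio: "max 2 (3 / (1 + t)) \<le> ?c" using \<epsilon> by linarith
    let ?A = "place_last critical"
    show ?thesis
    proof (intro exI[where x = "with_advice ?A"] allI impI)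
      fix \<sigma> assume "?ok \<sigma>"
      then have \<sigma>: "set \<sigma> \<subseteq> cbox 0 1" "set \<sigma> \<subseteq> diag_cone t" by auto
      define N where "N = card {i. i < length \<sigma> \<and> critical (\<sigma> ! i)}"
      note q = reserving_first_fit[OF \<sigma> t, folded N_def]
      have "max 2 (3 / (1 + t)) * real (opt \<sigma>) \<le> ?c * real (opt \<sigma>)"
        by (rule mult_right_mono[OF ratio]) simp
      then have bins: "real (num_bins (outcome (?A N) \<sigma>)) \<le> ?c * real (opt \<sigma>) + 1"
        using q(2) by linarith
      obtain tape b where run: "run (with_advice ?A) tape \<sigma> (outcome (?A N) \<sigma>) b"
          and b: "b \<le> length (code N)"
        using run_with_advice by blast
      have "real b \<le> 40 * (1 / \<epsilon>) * ln (real (length \<sigma>))" if "length \<sigma> \<ge> 2"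
      proof -
        have "N \<le> card {..<length \<sigma>}" unfolding N_def by (intro card_mono) auto
        then have "real b \<le> 10 * ln (real (length \<sigma>))"
          using advice_length_le[OF that, of N] b by simp
        also have "\<dots> \<le> 40 * (1 / \<epsilon>) * ln (real (length \<sigma>))"
          using \<epsilon> \<epsilon>4 that by (intro mult_right_mono) (auto simp: field_simps)
        finally show ?thesis .
      qed
      then show "\<exists>tape p b. run (with_advice ?A) tape \<sigma> p b \<and> feasible_packing \<sigma> p \<and>
          (length \<sigma> \<ge> 2 \<longrightarrow> real b \<le> 40 * (1 / \<epsilon>) * ln (real (length \<sigma>))) \<and>
          real (num_bins p) \<le> ?c * real (opt \<sigma>) + 1"
        using run q(1) bins by blast
    qed
  qed
  then obtain S where S: "\<forall>\<sigma>. ?ok \<sigma> \<longrightarrow> (\<exists>tape p b. run S tape \<sigma> p b \<and> feasible_packing \<sigma> p \<and>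
      (length \<sigma> \<ge> 2 \<longrightarrow> real b \<le> 40 * (1 / \<epsilon>) * ln (real (length \<sigma>))) \<and>
      real (num_bins p) \<le> ?c * real (opt \<sigma>) + 1)"
    by (rule exE)
  then show "\<exists>S::strategy. \<forall>\<sigma>::(real^2) list.
       (\<forall>v\<in>set \<sigma>. v \<in> cbox 0 1 \<and> angle v \<in> {pi/4 - \<gamma>/2 .. pi/4 + \<gamma>/2}) \<longrightarrow>
       (\<exists>tape p b. run S tape \<sigma> p b \<and> feasible_packing \<sigma> p \<and>
          (length \<sigma> \<ge> 2 \<longrightarrow> real b \<le> 40 * (1 / \<epsilon>) * ln (real (length \<sigma>))) \<and>
          real (num_bins p) \<le> max 2 (6 / (1 + 3 * tan (pi/4 - \<gamma>/2)) + \<epsilon>) * real (opt \<sigma>) + 1)"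
    unfolding a_def[symmetric] t_def[symmetric]
    by (intro exI[where x = S] allI impI S[rule_format]) (rule ok, simp add: a_def)
qed

end
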